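(* Let $a(x)=a_0+a_1 x +\cdots+a_d x^d$ be a polynomial with complex coefficients, where $a_0=1$, and suppose that every power series coefficient of $1/a(x)$ is $0$ or $1$. Then there exist a positive integer $m$ and a set $T\subseteq \{0,1,\dots, m-1\}$ with $0\in T$ such that \[ a(x)^{-1}=\sum_{t\in T^*} x^t, \] where $T^*$ is the set of nonnegative integers congruent modulo $m$ to an element of $T$. Moreover, \[ \biggl(\sum_{n=0}^d a_n \mathbf{h}_n\biggr)^{-1}=\sum_{L}\mathbf{r}_L, \] where the sum on the right is over all compositions $L$ with every part in $T^*$; and for each $n\ge0$ the coefficient of $x^n/n!$ in \[ \biggl(\sum_{n=0}^d a_n \frac{x^n}{n!}\biggr)^{-1} \] is the number of permutations of $[n]=\{1,\dots,n\}$ in which every increasing run length is in $T^*$.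
   Context: Let $X_1,X_2,\dots$ be noncommuting variables, and work in the ring of formal power series in these variables with complex coefficients. For $n\ge 0$ the complete noncommutative symmetric function is $\mathbf{h}_n=\sum_{i_1\le i_2\le\cdots\le i_n} X_{i_1}X_{i_2}\cdots X_{i_n}$ (so $\mathbf{h}_0=1$). A composition is a finite (possibly empty) sequence of positive integers; a composition of $n$ is one with sum $n$. For a composition $L=(L_1,\dots,L_k)$ of $n$, the ribbon noncommutative symmetric function is $\mathbf{r}_L=\sum X_{i_1}X_{i_2}\cdots X_{i_n}$, summed over all $i_1,\dots,i_n$ with $i_1\le\cdots\le i_{L_1} > i_{L_1+1}\le\cdots\le i_{L_1+L_2} > \cdots > i_{L_1+\cdots+L_{k-1}+1}\le\cdots\le i_n$; i.e., the sum of all words whose maximal weakly increasing runs have lengths $L_1,\dots,L_k$ in order (and $\mathbf{r}_{\emptyset}=1$). The increasing runs of a permutation in one-line notation are its maximal increasing consecutive subsequences.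
   Formalization: The polynomial a(x) is assumed nonconstant; this excludes only a(x)=1, for which the claim fails, since 1/a(x)=1 while 0 in T and m>0 make T* infinite. *)

theory Defs
  imports Complex_Main
    "HOL-Computational_Algebra.Polynomial_FPS"
    "HOL-Number_Theory.Cong"
    "HOL-Combinatorics.Permutations"
begin

text \<open>
  Formal power series in noncommuting variables \<open>X\<^sub>1, X\<^sub>2, \<dots>\<close>: arbitrary functions from words
  to coefficients. The letter \<open>i :: nat\<close> stands for the variable \<open>X\<^sub>i\<^sub>+\<^sub>1\<close>; only the order of
  the letters matters.
\<close>

typedef 'a ncps = "UNIV :: (nat list \<Rightarrow> 'a) set"
  morphisms ncps_coeff Abs_ncps ..

setup_lifting type_definition_ncps

lemma ncps_eqI: "(\<And>w. ncps_coeff f w = ncps_coeff g w) \<Longrightarrow> f = g"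
  by (simp add: ncps_coeff_inject[symmetric] fun_eq_iff)

lemma finite_factorizations [simp]: "finite {(u, v). u @ v = w}"
proof (rule finite_subset)
  show "{(u, v). u @ v = w} \<subseteq> (\<lambda>k. (take k w, drop k w)) ` {..length w}"
  proof
    fix p assume "p \<in> {(u, v). u @ v = w}"
    then show "p \<in> (\<lambda>k. (take k w, drop k w)) ` {..length w}"
      by (intro image_eqI[where x = "length (fst p)"]) auto
  qed
qed simp

instantiation ncps :: (ring_1) ring_1
begin

lift_definition zero_ncps :: "'a ncps" is "\<lambda>w. 0" .

lift_definition one_ncps :: "'a ncps" is "\<lambda>w. if w = [] then 1 else 0" .

lift_definition plus_ncps :: "'a ncps \<Rightarrow> 'a ncps \<Rightarrow> 'a ncps" is "\<lambda>f g w. f w + g w" .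

lift_definition minus_ncps :: "'a ncps \<Rightarrow> 'a ncps \<Rightarrow> 'a ncps" is "\<lambda>f g w. f w - g w" .

lift_definition uminus_ncps :: "'a ncps \<Rightarrow> 'a ncps" is "\<lambda>f w. - f w" .

lift_definition times_ncps :: "'a ncps \<Rightarrow> 'a ncps \<Rightarrow> 'a ncps"
  is "\<lambda>f g w. \<Sum>(u, v)\<in>{(u, v). u @ v = w}. f u * g v" .

instance
proof
  fix f g h :: "'a ncps"
  show "f * g * h = f * (g * h)"
  proof (transfer, rule ext)
    fix f g h :: "nat list \<Rightarrow> 'a" and w :: "nat list"
    let ?P = "\<lambda>w :: nat list. {(u, v). u @ v = w}"
    have "(\<Sum>(u, v)\<in>?P w. (\<Sum>(u, v)\<in>?P u. f u * g v) * h v) =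
      (\<Sum>p\<in>?P w. \<Sum>q\<in>?P (fst p). f (fst q) * g (snd q) * h (snd p))"
      by (simp add: sum_distrib_right case_prod_unfold)
    also have "\<dots> = (\<Sum>(p, q)\<in>(SIGMA p:?P w. ?P (fst p)). f (fst q) * g (snd q) * h (snd p))"
      by (rule sum.Sigma) simp_all
    also have "\<dots> = (\<Sum>(p, q)\<in>(SIGMA p:?P w. ?P (snd p)). f (fst p) * (g (fst q) * h (snd q)))"
      by (rule sum.reindex_bij_witness[where
          i = "\<lambda>(p, q). ((fst p @ fst q, snd q), (fst p, fst q))" and
          j = "\<lambda>(p, q). ((fst q, snd q @ snd p), (snd q, snd p))"])
        (auto simp: mult.assoc)
    also have "\<dots> = (\<Sum>p\<in>?P w. \<Sum>q\<in>?P (snd p). f (fst p) * (g (fst q) * h (snd q)))"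
      by (rule sum.Sigma[symmetric]) simp_all
    also have "\<dots> = (\<Sum>(u, v)\<in>?P w. f u * (\<Sum>(u, v)\<in>?P v. g u * h v))"
      by (simp add: sum_distrib_left case_prod_unfold)
    finally show "(\<Sum>(u, v)\<in>?P w. (\<Sum>(u, v)\<in>?P u. f u * g v) * h v) =
      (\<Sum>(u, v)\<in>?P w. f u * (\<Sum>(u, v)\<in>?P v. g u * h v))" .
  qed
  show "1 * f = f"
  proof (transfer, rule ext)
    fix f :: "nat list \<Rightarrow> 'a" and w :: "nat list"
    have "(\<Sum>(u, v)\<in>{(u, v). u @ v = w}. (if u = [] then 1 else 0) * f v) =
      (\<Sum>(u, v)\<in>{([] :: nat list, w)}. (if u = [] then 1 else 0) * f v)"
      by (rule sum.mono_neutral_right) (auto split: if_splits)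
    then show "(\<Sum>(u, v)\<in>{(u, v). u @ v = w}. (if u = [] then 1 else 0) * f v) = f w"
      by simp
  qed
  show "f * 1 = f"
  proof (transfer, rule ext)
    fix f :: "nat list \<Rightarrow> 'a" and w :: "nat list"
    have "(\<Sum>(u, v)\<in>{(u, v). u @ v = w}. f u * (if v = [] then 1 else 0)) =
      (\<Sum>(u, v)\<in>{(w, [] :: nat list)}. f u * (if v = [] then 1 else 0))"
      by (rule sum.mono_neutral_right) (auto split: if_splits)
    then show "(\<Sum>(u, v)\<in>{(u, v). u @ v = w}. f u * (if v = [] then 1 else 0)) = f w"
      by simp
  qed
  show "(f + g) * h = f * h + g * h"
    by transfer (simp add: case_prod_unfold distrib_right sum.distrib)
  show "f * (g + h) = f * g + f * h"
    by transfer (simp add: case_prod_unfold distrib_left sum.distrib)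
  show "f + g + h = f + (g + h)"
    by transfer (simp add: add.assoc)
  show "f + g = g + f"
    by transfer (simp add: add.commute)
  show "0 + f = f"
    by transfer simp
  show "- f + f = 0"
    by transfer simp
  show "f - g = f + - g"
    by transfer simp
  show "(0 :: 'a ncps) \<noteq> 1"
    by transfer (metis zero_neq_one)
qed

end

lift_definition ncps_smult :: "'a::ring_1 \<Rightarrow> 'a ncps \<Rightarrow> 'a ncps" is "\<lambda>c f w. c * f w" .

text \<open>The formal sum of all words in a (possibly infinite) set.\<close>

lift_definition ncps_of_words :: "nat list set \<Rightarrow> 'a::ring_1 ncps"
  is "\<lambda>W w. if w \<in> W then 1 else 0" .

text \<open>
  Possibly infinite sums of series: each word may receive a nonzero coefficient from only finitely
  many summands, and coefficients are added word by word.
\<close>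

definition ncps_has_sum :: "('i \<Rightarrow> 'a::ring_1 ncps) \<Rightarrow> 'i set \<Rightarrow> 'a ncps \<Rightarrow> bool" where
  "ncps_has_sum F I S \<longleftrightarrow> (\<forall>w. finite {i \<in> I. ncps_coeff (F i) w \<noteq> 0} \<and>
     ncps_coeff S w = (\<Sum>i \<in> {i \<in> I. ncps_coeff (F i) w \<noteq> 0}. ncps_coeff (F i) w))"

definition ncps_is_inverse :: "'a::ring_1 ncps \<Rightarrow> 'a ncps \<Rightarrow> bool" where
  "ncps_is_inverse f g \<longleftrightarrow> f * g = 1 \<and> g * f = 1"

definition nc_complete :: "nat \<Rightarrow> 'a::ring_1 ncps" where
  "nc_complete n = ncps_of_words {w. length w = n \<and> sorted w}"

definition is_composition :: "nat list \<Rightarrow> bool" where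
  "is_composition L \<longleftrightarrow> (\<forall>l \<in> set L. 0 < l)"

text \<open>The partial sums \<open>L\<^sub>1, L\<^sub>1 + L\<^sub>2, \<dots>, L\<^sub>1 + \<dots> + L\<^sub>k\<^sub>-\<^sub>1\<close>, without the total.\<close>

definition partial_sums :: "nat list \<Rightarrow> nat set" where
  "partial_sums L = {sum_list (take j L) | j. 1 \<le> j \<and> j < length L}"

text \<open>
  For a word \<open>X\<^sub>i\<^sub>1 \<dots> X\<^sub>i\<^sub>n\<close> with 1-based positions, the condition at \<open>s\<close> compares the letters at
  positions \<open>s\<close> and \<open>s + 1\<close>, which are \<open>w ! (s - 1)\<close> and \<open>w ! s\<close>. Meaningful for compositions \<open>L\<close>.
\<close>

definition nc_ribbon :: "nat list \<Rightarrow> 'a::ring_1 ncps" where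
  "nc_ribbon L = ncps_of_words {w. length w = sum_list L \<and>
     (\<forall>s. 1 \<le> s \<and> s < length w \<longrightarrow>
       (if s \<in> partial_sums L then w ! (s - 1) > w ! s else w ! (s - 1) \<le> w ! s))}"

definition residue_closure :: "nat \<Rightarrow> nat set \<Rightarrow> nat set" where
  "residue_closure m T = {k. \<exists>t \<in> T. [k = t] (mod m)}"

text \<open>
  \<open>increasing_segment w i j\<close>: the entries of \<open>w\<close> at the 0-based positions \<open>i, \<dots>, j - 1\<close> form a
  nonempty increasing sequence.
\<close>

definition increasing_segment :: "nat list \<Rightarrow> nat \<Rightarrow> nat \<Rightarrow> bool" where
  "increasing_segment w i j \<longleftrightarrow> i < j \<and> j \<le> length w \<and> sorted_wrt (<) (take (j - i) (drop i w))"

definition increasing_run :: "nat list \<Rightarrow> nat \<Rightarrow> nat \<Rightarrow> bool" where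
  "increasing_run w i j \<longleftrightarrow> increasing_segment w i j \<and>
     (\<forall>i' j'. i' \<le> i \<and> j \<le> j' \<and> increasing_segment w i' j' \<longrightarrow> i' = i \<and> j' = j)"

definition increasing_run_lengths :: "nat list \<Rightarrow> nat set" where
  "increasing_run_lengths w = {j - i | i j. increasing_run w i j}"

definition one_line :: "nat \<Rightarrow> (nat \<Rightarrow> nat) \<Rightarrow> nat list" where
  "one_line n p = map p [1..<Suc n]"

end

theory Submission
  imports Defs
begin

text \<open>
  Write \<open>1 / a(x) = \<Sum> b\<^sub>n x\<^sup>n\<close> and let \<open>S\<close> be the set of \<open>n\<close> with \<open>b\<^sub>n = 1\<close>. The coefficients \<open>b\<^sub>n\<close>
  satisfy a linear recurrence that determines the sequence in both directions, and they take
  finitely many values, so by the pigeonhole principle they are periodic from the start.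

  If a nonempty word \<open>w\<close> has first weakly increasing run of length \<open>l\<close>, its prefix of length \<open>k\<close> is
  sorted iff \<open>k \<le> l\<close>, and removing that prefix only shortens the first run to \<open>l - k\<close>. As \<open>0 \<in> S\<close>,
  summing \<open>a\<^sub>k\<close> over all ways to split \<open>w\<close> into a sorted prefix of length \<open>k\<close> and a word with run
  lengths in \<open>S\<close> gives either \<open>0\<close> or \<open>\<Sum> a\<^sub>k b\<^sub>l\<^sub>-\<^sub>k\<close>, which also vanishes. Read as a coefficient, this
  is the identity for ribbons. Summed over all arrangements of a finite set, it is the recurrence
  that characterises the coefficients of the exponential generating function.
\<close>

section \<open>Run lengths of words\<close>

text \<open>Runs are weakly increasing here, as the ribbons require; on words with distinct letters
  they coincide with strictly increasing runs.\<close>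

fun run_lengths :: "'a::linorder list \<Rightarrow> nat list" where
  "run_lengths [] = []"
| "run_lengths [x] = [1]"
| "run_lengths (x # y # w) =
    (if x \<le> y then Suc (hd (run_lengths (y # w))) # tl (run_lengths (y # w))
     else 1 # run_lengths (y # w))"

lemma run_lengths_eq_Nil_iff [simp]: "run_lengths w = [] \<longleftrightarrow> w = []"
  by (induction w rule: run_lengths.induct) auto

lemma is_composition_run_lengths: "is_composition (run_lengths w)"
proof (induction w rule: run_lengths.induct)
  case (3 x y w)
  then have "is_composition (run_lengths (y # w))" by blast
  moreover have "run_lengths (y # w) \<noteq> []" by simp
  ultimately show ?case
    by (cases "run_lengths (y # w)") (auto simp: is_composition_def)
qed (auto simp: is_composition_def)

lemma sum_list_run_lengths: "sum_list (run_lengths w) = length w"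
proof (induction w rule: run_lengths.induct)
  case (3 x y w)
  have "run_lengths (y # w) \<noteq> []" by simp
  with 3 show ?case
    by (cases "run_lengths (y # w)") auto
qed auto

text \<open>The first run is the longest sorted prefix. The bound on \<open>k\<close> matters
  because \<open>take\<close> saturates: past the end of a word with a single run, the prefix stays
  sorted although \<open>k\<close> exceeds \<open>l\<close>.\<close>

lemma sorted_take_iff_le_first_run:
  assumes "run_lengths w = l # L" and "k \<le> length w"
  shows "sorted (take k w) \<longleftrightarrow> k \<le> l"
  using assms
proof (induction w arbitrary: l L k rule: run_lengths.induct)
  case (3 x y w)
  obtain l' L' where L': "run_lengths (y # w) = l' # L'"
    by (cases "run_lengths (y # w)") auto
  show ?case
  proof (cases "k \<le> 1")
    case True
    have "0 < l" using "3.prems"(1) by (auto split: if_splits)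
    from True have "k = 0 \<or> k = 1" by auto
    then show ?thesis using \<open>0 < l\<close> by auto
  next
    case False
    then obtain k' where k: "k = Suc (Suc k')"
      by (metis One_nat_def not_less_eq_eq old.nat.exhaust zero_le)
    have iff: "sorted (take (Suc k') (y # w)) \<longleftrightarrow> Suc k' \<le> l'"
    proof (cases "x \<le> y")
      case True then show ?thesis using 3(1)[OF True L', of "Suc k'"] "3.prems"(2) k by simp
    next
      case False then show ?thesis using 3(3)[OF False L', of "Suc k'"] "3.prems"(2) k by simp
    qed
    have "sorted (take k (x # y # w)) \<longleftrightarrow> x \<le> y \<and> sorted (take (Suc k') (y # w))"
      by (auto simp: k)
    with iff show ?thesis using "3.prems"(1) L' k by (auto split: if_splits)
  qed
qed auto

text \<open>A cut inside the first run leaves all later runs intact. The case \<open>k = l\<close>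
  stands apart because an exhausted run disappears instead of leaving a part 0.\<close>

lemma run_lengths_drop:
  assumes "run_lengths w = l # L" and "k \<le> l"
  shows "run_lengths (drop k w) = (if k = l then L else (l - k) # L)"
  using assms
proof (induction w arbitrary: l L k rule: run_lengths.induct)
  case (2 x)
  then show ?case by (cases k) auto
next
  case (3 x y w)
  obtain l' L' where L': "run_lengths (y # w) = l' # L'"
    by (cases "run_lengths (y # w)") auto
  show ?case
  proof (cases k)
    case 0
    have "is_composition (l # L)"
      using is_composition_run_lengths[of "x # y # w"] unfolding "3.prems"(1) .
    then show ?thesis using 0 "3.prems"(1) by (auto simp: is_composition_def)
  next
    case (Suc k')
    show ?thesis
    proof (cases "x \<le> y")
      case True
      with 3(1)[OF True L', of k'] "3.prems" L' Suc show ?thesis by auto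
    next
      case False
      then show ?thesis using "3.prems" L' Suc by auto
    qed
  qed
qed auto

text \<open>Only cuts within the first run contribute. The condition on the later runs is then a
  common factor, and what remains is the recurrence at the length of the first run.\<close>

lemma convolution_run_lengths:
  fixes a :: "nat \<Rightarrow> 'a::ring_1"
  assumes S: "0 \<in> S"
    and a0: "a 0 = 1"
    and conv: "\<And>l. 0 < l \<Longrightarrow> (\<Sum>k\<le>l. a k * (if l - k \<in> S then 1 else 0)) = 0"
  shows "(\<Sum>k\<le>length w. (if sorted (take k w) then a k else 0) *
      (if set (run_lengths (drop k w)) \<subseteq> S then 1 else 0)) = (if w = [] then 1 else 0)"
proof (cases "run_lengths w")
  case Nil
  then show ?thesis using a0 by simp
next
  case (Cons l L)
  have "l \<le> length w" using sum_list_run_lengths[of w] Cons by simp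
  have "0 < l" using is_composition_run_lengths[of w] Cons by (simp add: is_composition_def)
  have "(\<Sum>k\<le>length w. (if sorted (take k w) then a k else 0) *
      (if set (run_lengths (drop k w)) \<subseteq> S then 1 else 0)) =
    (\<Sum>k\<le>l. (if sorted (take k w) then a k else 0) *
      (if set (run_lengths (drop k w)) \<subseteq> S then 1 else 0))"
    using \<open>l \<le> length w\<close> sorted_take_iff_le_first_run[OF Cons]
    by (intro sum.mono_neutral_right) auto
  \<comment> \<open>At \<open>k = l\<close> the first run is gone and imposes no condition;
    \<open>0 \<in> S\<close> lets this cut be written like the others.\<close>
  also have "\<dots> = (\<Sum>k\<le>l. (a k * (if l - k \<in> S then 1 else 0)) *
      (if set L \<subseteq> S then 1 else 0))"
    using \<open>l \<le> length w\<close> S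
    by (intro sum.cong) (auto simp: sorted_take_iff_le_first_run[OF Cons] run_lengths_drop[OF Cons])
  also have "\<dots> = 0"
    using conv[OF \<open>0 < l\<close>] by (simp only: sum_distrib_right[symmetric] mult_zero_left)
  finally show ?thesis using Cons by auto
qed

section \<open>Ribbons and maximal increasing runs\<close>

text \<open>A descent is indexed by the number of letters before it, which makes descents directly
  comparable with \<open>partial_sums\<close>.\<close>

definition descents :: "'a::linorder list \<Rightarrow> nat set" where
  "descents w = {s. 1 \<le> s \<and> s < length w \<and> w ! s < w ! (s - 1)}"

lemma descents_Cons_Cons:
  "descents (x # y # w) = (if x \<le> y then {} else {1}) \<union> Suc ` descents (y # w)"
proof (rule set_eqI)
  fix s
  show "s \<in> descents (x # y # w) \<longleftrightarrow>
    s \<in> (if x \<le> y then {} else {1}) \<union> Suc ` descents (y # w)"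
  proof (cases s)
    case 0
    then show ?thesis by (auto simp: descents_def)
  next
    case (Suc t)
    then show ?thesis by (cases t) (auto simp: descents_def image_iff)
  qed
qed

text \<open>Counterpart of a strict descent at the front in \<open>descents_Cons_Cons\<close>. A
  lone part 1 creates no break point, since the total is not a partial sum.\<close>

lemma partial_sums_one_Cons:
  "partial_sums (Suc 0 # L) = (if L = [] then {} else insert 1 (Suc ` partial_sums L))"
proof (rule set_eqI)
  fix s
  have "s \<in> partial_sums (Suc 0 # L) \<longleftrightarrow>
    (\<exists>j. s = sum_list (take (Suc j) (Suc 0 # L)) \<and> j < length L)"
  proof
    assume "s \<in> partial_sums (Suc 0 # L)"
    then obtain j where "s = sum_list (take j (Suc 0 # L))" "1 \<le> j" "j < Suc (length L)"
      by (auto simp: partial_sums_def)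
    then show "\<exists>j. s = sum_list (take (Suc j) (Suc 0 # L)) \<and> j < length L"
      by (intro exI[of _ "j - 1"]) auto
  next
    assume "\<exists>j. s = sum_list (take (Suc j) (Suc 0 # L)) \<and> j < length L"
    then obtain j where "s = sum_list (take (Suc j) (Suc 0 # L))" "j < length L"
      by blast
    then show "s \<in> partial_sums (Suc 0 # L)"
      unfolding partial_sums_def by (intro CollectI exI[of _ "Suc j"]) auto
  qed
  also have "\<dots> \<longleftrightarrow> (\<exists>j. s = Suc (sum_list (take j L)) \<and> j < length L)" by simp
  also have "\<dots> \<longleftrightarrow> s \<in> (if L = [] then {} else insert 1 (Suc ` partial_sums L))"
  proof (cases "L = []")
    case False
    have "(\<exists>j. s = Suc (sum_list (take j L)) \<and> j < length L) \<longleftrightarrow>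
      s = 1 \<or> (\<exists>j. s = Suc (sum_list (take j L)) \<and> 1 \<le> j \<and> j < length L)"
      (is "(\<exists>j. ?P j \<and> _ j) \<longleftrightarrow> _")
    proof
      assume "\<exists>j. ?P j \<and> j < length L"
      then obtain j where "?P j" "j < length L" by blast
      then show "s = 1 \<or> (\<exists>j. ?P j \<and> 1 \<le> j \<and> j < length L)" by (cases j) auto
    next
      assume "s = 1 \<or> (\<exists>j. ?P j \<and> 1 \<le> j \<and> j < length L)"
      moreover have "?P 0 \<and> 0 < length L" if "s = 1" using that False by simp
      ultimately show "\<exists>j. ?P j \<and> j < length L" by blast
    qed
    then show ?thesis using False by (auto simp: partial_sums_def)
  qed simp
  finally show "s \<in> partial_sums (Suc 0 # L) \<longleftrightarrow>
    s \<in> (if L = [] then {} else insert 1 (Suc ` partial_sums L))" .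
qed

text \<open>Counterpart of a weak ascent at the front: every partial sum contains the first part, so
  enlarging that part shifts them all.\<close>

lemma partial_sums_Suc_Cons:
  "partial_sums (Suc l # L) = Suc ` partial_sums (l # L)"
proof -
  have "sum_list (take j (Suc l # L)) = Suc (sum_list (take j (l # L)))" if "1 \<le> j" for j
    using that by (cases j) auto
  then show ?thesis
    by (force simp: partial_sums_def image_iff)
qed

lemma partial_sums_pos: "is_composition L \<Longrightarrow> s \<in> partial_sums L \<Longrightarrow> 0 < s"
  by (cases L) (auto simp: partial_sums_def is_composition_def take_Cons' split: if_splits)

lemma partial_sums_less_sum_list:
  assumes "is_composition L" "s \<in> partial_sums L"
  shows "s < sum_list L"
proof -
  obtain j where j: "s = sum_list (take j L)" "j < length L"
    using assms(2) by (auto simp: partial_sums_def)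
  have "sum_list L = sum_list (take j L) + (L ! j + sum_list (drop (Suc j) L))"
    by (metis Cons_nth_drop_Suc append_take_drop_id j(2) sum_list.Cons sum_list_append)
  moreover have "0 < L ! j" using assms(1) j(2) by (simp add: is_composition_def)
  ultimately show ?thesis using j(1) by linarith
qed

text \<open>A composition is determined by its total and its partial sums, and the breaks between
  the runs of \<open>w\<close> are its descents. In the induction, a first part 1 means that
  \<open>x\<close> stands alone before a descent, a larger one that \<open>x\<close> extends the
  first run of \<open>y # w\<close>.\<close>

lemma run_lengths_eq_iff:
  "run_lengths w = L \<longleftrightarrow>
    is_composition L \<and> length w = sum_list L \<and> descents w = partial_sums L"
proof (induction w arbitrary: L rule: run_lengths.induct)
  case 1
  show ?case
    by (cases L) (auto simp: is_composition_def descents_def partial_sums_def)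
next
  case (2 x)
  have "L = [Suc 0]" if "is_composition L" "sum_list L = Suc 0"
  proof (cases L)
    case (Cons l M)
    then have "0 < l" "l + sum_list M = Suc 0" using that by (auto simp: is_composition_def)
    then have "l = Suc 0" "sum_list M = 0" by linarith+
    then have "M = []" using that Cons by (cases M) (auto simp: is_composition_def)
    then show ?thesis using Cons \<open>l = Suc 0\<close> by simp
  qed (use that in auto)
  then show ?case
    by (auto simp: is_composition_def descents_def partial_sums_def)
next
  case (3 x y w)
  have IH: "run_lengths (y # w) = M \<longleftrightarrow>
    is_composition M \<and> length (y # w) = sum_list M \<and> descents (y # w) = partial_sums M" for M
    using 3 by blast
  have inj: "Suc ` A = Suc ` B \<longleftrightarrow> A = B" for A B :: "nat set"
    by (simp add: inj_image_eq_iff)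
  have ne: "run_lengths (y # w) \<noteq> []" by simp
  have d0: "0 \<notin> descents (y # w)" by (simp add: descents_def)
  show ?case
  proof (cases L)
    case Nil
    then show ?thesis by simp
  next
    case (Cons l M)
    consider "l = 0" | "l = Suc 0" | l' where "l = Suc (Suc l')"
      by (metis old.nat.exhaust)
    then show ?thesis
    proof cases
      case 1
      have "is_composition (run_lengths (x # y # w))" by (rule is_composition_run_lengths)
      then show ?thesis using 1 Cons by (auto simp: is_composition_def)
    next
      case 2
      have pos: "0 < hd (run_lengths (y # w))"
        using is_composition_run_lengths[of "y # w"] ne
        by (cases "run_lengths (y # w)") (auto simp: is_composition_def)
      have lhs: "run_lengths (x # y # w) = L \<longleftrightarrow> \<not> x \<le> y \<and> run_lengths (y # w) = M"
        using 2 Cons pos by auto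
      have comp: "is_composition L \<longleftrightarrow> is_composition M"
        using 2 Cons by (simp add: is_composition_def)
      have "descents (x # y # w) = partial_sums L \<longleftrightarrow>
          \<not> x \<le> y \<and> descents (y # w) = partial_sums M"
        if M: "is_composition M" "length (y # w) = sum_list M"
      proof -
        have "M \<noteq> []" using M by auto
        have p0: "0 \<notin> partial_sums M" using partial_sums_pos[OF M(1)] by blast
        \<comment> \<open>Shifted break points are at least 2, so membership of 1 alone decides
          between descent and ascent.\<close>
        have "1 \<notin> Suc ` descents (y # w)" "1 \<notin> Suc ` partial_sums M"
          using d0 p0 by auto
        then show ?thesis
          using 2 Cons \<open>M \<noteq> []\<close> inj
          by (auto simp: descents_Cons_Cons partial_sums_one_Cons insert_ident)
      qed
      then show ?thesis
        unfolding lhs comp IH using 2 Cons by auto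
    next
      case 3
      have lhs: "run_lengths (x # y # w) = L \<longleftrightarrow> x \<le> y \<and> run_lengths (y # w) = Suc l' # M"
        using 3 Cons ne by (cases "run_lengths (y # w)") auto
      have comp: "is_composition L \<longleftrightarrow> is_composition (Suc l' # M)"
        using 3 Cons by (simp add: is_composition_def)
      have "descents (x # y # w) = partial_sums L \<longleftrightarrow>
          x \<le> y \<and> descents (y # w) = partial_sums (Suc l' # M)"
        if M: "is_composition (Suc l' # M)"
      proof -
        have p: "1 \<notin> Suc ` partial_sums (Suc l' # M)" using partial_sums_pos[OF M] by force
        then show ?thesis
          unfolding Cons 3 descents_Cons_Cons partial_sums_Suc_Cons[of "Suc l'"]
          using inj by (cases "x \<le> y") (simp_all, blast)
      qed
      then show ?thesis
        unfolding lhs comp IH using 3 Cons by auto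
    qed
  qed
qed

text \<open>The partial sums of a composition lie strictly between 0 and the total, so the
  conditions on \<open>s\<close> see all of them and say that the descent set is exactly
  \<open>partial_sums L\<close>.\<close>

lemma nc_ribbon_eq_of_run_lengths:
  assumes "is_composition L"
  shows "nc_ribbon L = ncps_of_words {w. run_lengths w = L}"
proof -
  have "(\<forall>s. 1 \<le> s \<and> s < length w \<longrightarrow>
      (if s \<in> partial_sums L then w ! (s - 1) > w ! s else w ! (s - 1) \<le> w ! s)) \<longleftrightarrow>
    descents w = partial_sums L" if "length w = sum_list L" for w :: "nat list"
    using partial_sums_pos[OF assms] partial_sums_less_sum_list[OF assms] that
    by (auto simp: descents_def set_eq_iff Suc_le_eq not_less split: if_splits)
  then have "length w = sum_list L \<and> (\<forall>s. 1 \<le> s \<and> s < length w \<longrightarrow>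
      (if s \<in> partial_sums L then w ! (s - 1) > w ! s else w ! (s - 1) \<le> w ! s)) \<longleftrightarrow>
    run_lengths w = L" for w :: "nat list"
    unfolding run_lengths_eq_iff using assms by blast
  then show ?thesis unfolding nc_ribbon_def by (simp only:)
qed

text \<open>Every word belongs to exactly one ribbon, that of its own run lengths, so at most one
  summand is nonzero at each word.\<close>

lemma ncps_has_sum_nc_ribbon:
  "ncps_has_sum nc_ribbon {L. is_composition L \<and> set L \<subseteq> S}
    (ncps_of_words {w. set (run_lengths w) \<subseteq> S} :: 'a::ring_1 ncps)"
  unfolding ncps_has_sum_def
proof (intro allI)
  fix w
  have coeff: "ncps_coeff (nc_ribbon L :: 'a ncps) w = (if run_lengths w = L then 1 else 0)"
    if "is_composition L" for L
    by (simp add: nc_ribbon_eq_of_run_lengths[OF that] ncps_of_words.rep_eq)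
  have supp: "{L \<in> {L. is_composition L \<and> set L \<subseteq> S}. ncps_coeff (nc_ribbon L :: 'a ncps) w \<noteq> 0} =
    (if set (run_lengths w) \<subseteq> S then {run_lengths w} else {})"
    using is_composition_run_lengths[of w] by (auto simp: coeff split: if_splits)
  show "finite {L \<in> {L. is_composition L \<and> set L \<subseteq> S}. ncps_coeff (nc_ribbon L :: 'a ncps) w \<noteq> 0} \<and>
    ncps_coeff (ncps_of_words {w. set (run_lengths w) \<subseteq> S} :: 'a ncps) w =
    (\<Sum>L\<in>{L \<in> {L. is_composition L \<and> set L \<subseteq> S}. ncps_coeff (nc_ribbon L :: 'a ncps) w \<noteq> 0}.
      ncps_coeff (nc_ribbon L) w)"
    unfolding supp
    by (auto simp: ncps_of_words.rep_eq coeff is_composition_run_lengths)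
qed

section \<open>Maximal increasing runs of words with distinct letters\<close>

lemma increasing_segment_iff:
  assumes "distinct w"
  shows "increasing_segment w i j \<longleftrightarrow>
    i < j \<and> j \<le> length w \<and> (\<forall>s. i < s \<and> s < j \<longrightarrow> s \<notin> descents w)"
proof -
  have "sorted_wrt (<) (take (j - i) (drop i w)) \<longleftrightarrow> (\<forall>s. i < s \<and> s < j \<longrightarrow> s \<notin> descents w)"
    if ij: "i < j" "j \<le> length w"
  proof -
    have "sorted_wrt (<) (take (j - i) (drop i w)) \<longleftrightarrow>
      (\<forall>t. Suc t < j - i \<longrightarrow> w ! (i + t) < w ! Suc (i + t))"
      using ij by (subst sorted_wrt_iff_nth_Suc_transp) (auto simp: min_def)
    also have "\<dots> \<longleftrightarrow> (\<forall>s. i < s \<and> s < j \<longrightarrow> w ! (s - 1) < w ! s)"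
    proof safe
      fix s assume H: "\<forall>t. Suc t < j - i \<longrightarrow> w ! (i + t) < w ! Suc (i + t)" and s: "i < s" "s < j"
      then show "w ! (s - 1) < w ! s" using H[rule_format, of "s - 1 - i"] by auto
    next
      fix t assume H: "\<forall>s. i < s \<and> s < j \<longrightarrow> w ! (s - 1) < w ! s" and t: "Suc t < j - i"
      then show "w ! (i + t) < w ! Suc (i + t)" using H[rule_format, of "Suc (i + t)"] by auto
    qed
    also have "\<dots> \<longleftrightarrow> (\<forall>s. i < s \<and> s < j \<longrightarrow> s \<notin> descents w)"
    proof -
      have "w ! (s - 1) < w ! s \<longleftrightarrow> s \<notin> descents w" if "i < s" "s < j" for s
      proof -
        \<comment> \<open>Distinctness enters here: neighbours differ, so the absence of a descent
          is a strict ascent.\<close>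
        have "w ! (s - 1) \<noteq> w ! s"
          using assms that ij by (simp add: nth_eq_iff_index_eq)
        then show ?thesis using that ij by (auto simp: descents_def)
      qed
      then show ?thesis by blast
    qed
    finally show ?thesis .
  qed
  then show ?thesis by (auto simp: increasing_segment_def)
qed

text \<open>Maximality need only be tested by adding one letter at either end, which is impossible
  exactly at a descent or at an end of the word; any longer segment would have such a descent in its
  interior.\<close>

lemma increasing_run_iff:
  assumes "distinct w"
  shows "increasing_run w i j \<longleftrightarrow>
    i < j \<and> j \<le> length w \<and> (\<forall>s. i < s \<and> s < j \<longrightarrow> s \<notin> descents w) \<and>
    (i = 0 \<or> i \<in> descents w) \<and> (j = length w \<or> j \<in> descents w)"
proof
  assume run: "increasing_run w i j"
  then have seg: "increasing_segment w i j"
    and max: "\<And>i' j'. i' \<le> i \<Longrightarrow> j \<le> j' \<Longrightarrow> increasing_segment w i' j' \<Longrightarrow> i' = i \<and> j' = j"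
    by (auto simp: increasing_run_def)
  note seg' = seg[unfolded increasing_segment_iff[OF assms]]
  have "i \<in> descents w" if "i \<noteq> 0"
  proof (rule ccontr)
    assume "i \<notin> descents w"
    then have "increasing_segment w (i - 1) j"
      using seg' that unfolding increasing_segment_iff[OF assms]
      by (metis Suc_pred' bot_nat_0.not_eq_extremum less_antisym less_imp_diff_less not_less_eq)
    then show False using max[of "i - 1" j] that by auto
  qed
  moreover have "j \<in> descents w" if "j \<noteq> length w"
  proof (rule ccontr)
    assume "j \<notin> descents w"
    then have "increasing_segment w i (Suc j)"
      using seg' that unfolding increasing_segment_iff[OF assms]
      by (auto simp: less_Suc_eq)
    then show False using max[of i "Suc j"] that by auto
  qed
  ultimately show "i < j \<and> j \<le> length w \<and> (\<forall>s. i < s \<and> s < j \<longrightarrow> s \<notin> descents w) \<and>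
    (i = 0 \<or> i \<in> descents w) \<and> (j = length w \<or> j \<in> descents w)"
    using seg' by blast
next
  assume *: "i < j \<and> j \<le> length w \<and> (\<forall>s. i < s \<and> s < j \<longrightarrow> s \<notin> descents w) \<and>
    (i = 0 \<or> i \<in> descents w) \<and> (j = length w \<or> j \<in> descents w)"
  show "increasing_run w i j"
    unfolding increasing_run_def increasing_segment_iff[OF assms]
  proof (intro conjI allI impI)
    fix i' j'
    assume H: "i' \<le> i \<and> j \<le> j' \<and> i' < j' \<and> j' \<le> length w \<and>
      (\<forall>s. i' < s \<and> s < j' \<longrightarrow> s \<notin> descents w)"
    show "i' = i" using H * by (metis le_neq_implies_less less_le_trans not_less_zero)
    show "j' = j" using H * by (metis le_neq_implies_less le_less_trans leD)
  qed (use * in auto)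
qed

text \<open>Maximal runs are the gaps between consecutive break points, and the gaps between
  consecutive partial sums are the parts of \<open>run_lengths w\<close>.\<close>

lemma increasing_run_lengths_eq:
  assumes "distinct w"
  shows "increasing_run_lengths w = set (run_lengths w)"
proof -
  define L where "L = run_lengths w"
  \<comment> \<open>Unlike \<open>partial_sums\<close>, the values of \<open>p\<close> up to
    \<open>length L\<close> include 0 and the total, the two ends of the word.\<close>
  define p where "p k = sum_list (take k L)" for k
  have comp: "is_composition L" and len: "length w = p (length L)"
    and desc: "descents w = partial_sums L"
    using run_lengths_eq_iff[of w L] by (auto simp: L_def p_def)
  have desc': "descents w = {p k | k. 1 \<le> k \<and> k < length L}"
    unfolding desc partial_sums_def p_def ..
  have p_Suc: "p (Suc k) = p k + L ! k" if "k < length L" for k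
    using that by (simp add: p_def take_Suc_conv_app_nth)
  have p_less: "p k < p k'" if "k < k'" "k' \<le> length L" for k k'
    using that
  proof (induction k')
    case (Suc k')
    have "0 < L ! k'" using comp Suc.prems by (simp add: is_composition_def)
    then show ?case using Suc p_Suc[of k'] by (cases "k = k'") auto
  qed simp
  have p_less_iff: "p k < p k' \<longleftrightarrow> k < k'" if "k \<le> length L" "k' \<le> length L" for k k'
    using p_less that by (metis linorder_neqE_nat order.asym less_irrefl)
  have p0: "p 0 = 0" by (simp add: p_def)
  have run: "increasing_run w i j \<longleftrightarrow> (\<exists>k<length L. i = p k \<and> j = p (Suc k))" for i j
  proof
    assume "increasing_run w i j"
    then have ij: "i < j" "j \<le> length w" and gap: "\<And>s. i < s \<Longrightarrow> s < j \<Longrightarrow> s \<notin> descents w"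
      and i: "i = 0 \<or> i \<in> descents w" and j: "j = length w \<or> j \<in> descents w"
      by (auto simp: increasing_run_iff[OF assms])
    obtain k where k: "i = p k" "k \<le> length L"
      using i p0 unfolding desc' by fastforce
    obtain k' where k': "j = p k'" "k' \<le> length L"
      using j len unfolding desc' by fastforce
    have "k < k'" using ij k k' p_less_iff by blast
    have "k' = Suc k"
    proof (rule ccontr)
      assume "k' \<noteq> Suc k"
      then have "Suc k < k'" using \<open>k < k'\<close> by simp
      then have "p (Suc k) \<in> descents w" using k' unfolding desc' by fastforce
      moreover have "i < p (Suc k)" "p (Suc k) < j"
        using \<open>Suc k < k'\<close> k k' by (auto intro: p_less)
      ultimately show False using gap by blast
    qed
    then show "\<exists>k<length L. i = p k \<and> j = p (Suc k)"
      using k k' by (intro exI[of _ k]) auto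
  next
    assume "\<exists>k<length L. i = p k \<and> j = p (Suc k)"
    then obtain k where k: "k < length L" "i = p k" "j = p (Suc k)" by blast
    have "i < j" using k p_less by auto
    moreover have "j \<le> length w"
      using k p_less[of "Suc k" "length L"] len by (cases "Suc k = length L") auto
    moreover have "s \<notin> descents w" if "i < s" "s < j" for s
    proof
      assume "s \<in> descents w"
      then obtain k' where "s = p k'" "k' < length L" unfolding desc' by blast
      then show False using that k p_less_iff[of k k'] p_less_iff[of k' "Suc k"] by auto
    qed
    moreover have "i = 0 \<or> i \<in> descents w"
      using k p0 unfolding desc' by (cases k) auto
    moreover have "j = length w \<or> j \<in> descents w"
      using k len unfolding desc' by (cases "Suc k = length L") auto
    ultimately show "increasing_run w i j" by (simp add: increasing_run_iff[OF assms])
  qed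
  show ?thesis
    unfolding increasing_run_lengths_def run
    by (auto simp: L_def[symmetric] in_set_conv_nth p_Suc) (metis diff_add_inverse p_Suc)
qed

section \<open>Inverses of noncommutative power series\<close>

text \<open>A factorization of a word is determined by the length of its first factor; this puts
  products in the shape of \<open>convolution_run_lengths\<close>.\<close>

lemma ncps_coeff_times:
  "ncps_coeff (f * g) w = (\<Sum>k\<le>length w. ncps_coeff f (take k w) * ncps_coeff g (drop k w))"
proof -
  have "ncps_coeff (f * g) w = (\<Sum>(u, v)\<in>{(u, v). u @ v = w}. ncps_coeff f u * ncps_coeff g v)"
    by (simp add: times_ncps.rep_eq)
  also have "\<dots> = (\<Sum>k\<le>length w. ncps_coeff f (take k w) * ncps_coeff g (drop k w))"
    by (rule sum.reindex_bij_witness[where i = "\<lambda>k. (take k w, drop k w)" and j = "\<lambda>(u, v). length u"])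
      auto
  finally show ?thesis .
qed

text \<open>Induction on length: in each term of the coefficient of \<open>f * f\<close>, either the
  first factor is the vanishing constant term or the second belongs to a shorter word.\<close>

lemma ncps_idempotent_eq_0:
  fixes f :: "'a::ring_1 ncps"
  assumes "f * f = f" "ncps_coeff f [] = 0"
  shows "f = 0"
proof (rule ncps_eqI)
  fix w
  show "ncps_coeff f w = ncps_coeff 0 w"
  proof (induction w rule: length_induct)
    case (1 w)
    have "ncps_coeff f w = (\<Sum>k\<le>length w. ncps_coeff f (take k w) * ncps_coeff f (drop k w))"
      using ncps_coeff_times[of f f w] assms(1) by simp
    also have "\<dots> = 0"
    proof (rule sum.neutral, rule ballI)
      fix k assume "k \<in> {..length w}"
      show "ncps_coeff f (take k w) * ncps_coeff f (drop k w) = 0"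
      proof (cases "k = 0 \<or> w = []")
        case True
        then show ?thesis using assms(2) by auto
      next
        case False
        then have "length (drop k w) < length w" by simp
        then show ?thesis using 1 by (simp add: zero_ncps.rep_eq)
      qed
    qed
    finally show ?case by (simp add: zero_ncps.rep_eq)
  qed
qed

text \<open>If \<open>f g = 1\<close> then \<open>1 - g f\<close> is idempotent, so a one-sided inverse suffices.\<close>

lemma ncps_is_inverseI:
  fixes f g :: "'a::ring_1 ncps"
  assumes fg: "f * g = 1" and "ncps_coeff f [] = 1" "ncps_coeff g [] = 1"
  shows "ncps_is_inverse f g"
proof -
  have "(g * f) * (g * f) = g * f"
    using fg by (metis mult.assoc mult_1_right)
  then have "(1 - g * f) * (1 - g * f) = 1 - g * f"
    by (simp add: algebra_simps)
  moreover have "ncps_coeff (1 - g * f) [] = 0"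
    using assms by (simp add: minus_ncps.rep_eq one_ncps.rep_eq ncps_coeff_times)
  ultimately have "1 - g * f = 0" by (rule ncps_idempotent_eq_0)
  then show ?thesis using fg by (simp add: ncps_is_inverse_def)
qed

lemma ncps_coeff_sum: "ncps_coeff (sum F I) w = (\<Sum>i\<in>I. ncps_coeff (F i) w)"
  by (induction I rule: infinite_finite_induct) (auto simp: zero_ncps.rep_eq plus_ncps.rep_eq)

text \<open>The left series has coefficient \<open>a (length w)\<close> at sorted words and 0
  elsewhere, where the vanishing of \<open>a\<close> beyond \<open>d\<close> covers long words.
  Hence each coefficient of the product is a sum as in
  \<open>convolution_run_lengths\<close>.\<close>

lemma ncps_is_inverse_run_lengths:
  fixes a :: "nat \<Rightarrow> 'a::ring_1"
  assumes "0 \<in> S" and "a 0 = 1" and "\<And>k. d < k \<Longrightarrow> a k = 0"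
    and "\<And>l. 0 < l \<Longrightarrow> (\<Sum>k\<le>l. a k * (if l - k \<in> S then 1 else 0)) = 0"
  shows "ncps_is_inverse (\<Sum>n\<le>d. ncps_smult (a n) (nc_complete n))
    (ncps_of_words {w. set (run_lengths w) \<subseteq> S})"
proof -
  have coeff: "ncps_coeff (\<Sum>n\<le>d. ncps_smult (a n) (nc_complete n)) w =
    (if sorted w then a (length w) else 0)" for w
  proof -
    have "ncps_coeff (\<Sum>n\<le>d. ncps_smult (a n) (nc_complete n)) w =
      (\<Sum>n\<le>d. if n = length w then (if sorted w then a n else 0) else 0)"
      unfolding ncps_coeff_sum
      by (intro sum.cong) (auto simp: ncps_smult.rep_eq nc_complete_def ncps_of_words.rep_eq)
    then show ?thesis using assms(3) by (simp add: not_le)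
  qed
  show ?thesis
  proof (rule ncps_is_inverseI)
    show "(\<Sum>n\<le>d. ncps_smult (a n) (nc_complete n)) *
      ncps_of_words {w. set (run_lengths w) \<subseteq> S} = 1"
    proof (rule ncps_eqI)
      fix w
      have "ncps_coeff ((\<Sum>n\<le>d. ncps_smult (a n) (nc_complete n)) *
          ncps_of_words {w. set (run_lengths w) \<subseteq> S}) w =
        (\<Sum>k\<le>length w. (if sorted (take k w) then a k else 0) *
          (if set (run_lengths (drop k w)) \<subseteq> S then 1 else 0))"
        unfolding ncps_coeff_times coeff
        by (intro sum.cong) (auto simp: ncps_of_words.rep_eq min_def)
      also have "\<dots> = ncps_coeff 1 w"
        by (subst convolution_run_lengths) (use assms in \<open>auto simp: one_ncps.rep_eq\<close>)
      finally show "ncps_coeff ((\<Sum>n\<le>d. ncps_smult (a n) (nc_complete n)) *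
          ncps_of_words {w. set (run_lengths w) \<subseteq> S}) w = ncps_coeff 1 w" .
    qed
  qed (use assms in \<open>auto simp: coeff ncps_of_words.rep_eq\<close>)
qed

section \<open>Counting permutations by run lengths\<close>

text \<open>A set \<open>K\<close> with an arrangement of \<open>A - K\<close> amounts to an
  arrangement of \<open>A\<close> with a marked sorted prefix: list \<open>K\<close> increasingly
  and append. Regrouped by the full word, the sum becomes that of
  \<open>convolution_run_lengths\<close>.\<close>

lemma sum_card_arrangements:
  fixes a :: "nat \<Rightarrow> 'a::comm_ring_1" and A :: "'b::linorder set"
  assumes "0 \<in> S" and "a 0 = 1"
    and "\<And>l. 0 < l \<Longrightarrow> (\<Sum>k\<le>l. a k * (if l - k \<in> S then 1 else 0)) = 0"
    and "finite A"
  shows "(\<Sum>K\<in>Pow A. a (card K) *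
      of_nat (card {w. distinct w \<and> set w = A - K \<and> set (run_lengths w) \<subseteq> S})) =
    (if A = {} then 1 else 0)"
proof -
  define P where "P B = {w. distinct w \<and> set w = B}" for B :: "'b set"
  define G where "G B = {w. distinct w \<and> set w = B \<and> set (run_lengths w) \<subseteq> S}" for B :: "'b set"
  have fP: "finite (P B)" if "finite B" for B
    by (rule finite_subset[OF _ finite_lists_length_eq[OF that, of "card B"]])
      (auto simp: P_def distinct_card)
  have fG: "finite (G B)" if "finite B" for B
    using fP[OF that] by (rule finite_subset[rotated]) (auto simp: G_def P_def)
  have "(\<Sum>K\<in>Pow A. a (card K) * of_nat (card (G (A - K)))) =
    (\<Sum>K\<in>Pow A. \<Sum>v\<in>G (A - K). a (card K))"
    by (simp add: mult.commute)
  also have "\<dots> = (\<Sum>(K, v)\<in>(SIGMA K:Pow A. G (A - K)). a (card K))"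
    using assms(4) fG by (intro sum.Sigma) auto
  also have "\<dots> = (\<Sum>(w, k)\<in>(SIGMA w:P A.
      {k. k \<le> length w \<and> sorted (take k w) \<and> set (run_lengths (drop k w)) \<subseteq> S}). a k)"
  proof (rule sum.reindex_bij_witness[where
        j = "\<lambda>(K, v). (sorted_list_of_set K @ v, card K)" and
        i = "\<lambda>(w, k). (set (take k w), drop k w)"])
    fix x assume "x \<in> (SIGMA K:Pow A. G (A - K))"
    then obtain K v where x: "x = (K, v)" "K \<subseteq> A" "v \<in> G (A - K)" by auto
    have fin: "finite K" using x assms(4) finite_subset by blast
    show "(case case x of (K, v) \<Rightarrow> (sorted_list_of_set K @ v, card K) of
        (w, k) \<Rightarrow> (set (take k w), drop k w)) = x"
      using x fin by simp
    show "(case x of (K, v) \<Rightarrow> (sorted_list_of_set K @ v, card K)) \<in> (SIGMA w:P A.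
      {k. k \<le> length w \<and> sorted (take k w) \<and> set (run_lengths (drop k w)) \<subseteq> S})"
      using x fin by (auto simp: P_def G_def)
    show "(case case x of (K, v) \<Rightarrow> (sorted_list_of_set K @ v, card K) of (w, k) \<Rightarrow> a k) =
      (case x of (K, v) \<Rightarrow> a (card K))"
      using x by simp
  next
    fix y assume "y \<in> (SIGMA w:P A.
      {k. k \<le> length w \<and> sorted (take k w) \<and> set (run_lengths (drop k w)) \<subseteq> S})"
    then obtain w k where y: "y = (w, k)" "distinct w" "set w = A" "k \<le> length w"
      "sorted (take k w)" "set (run_lengths (drop k w)) \<subseteq> S" by (auto simp: P_def)
    have "sorted_list_of_set (set (take k w)) = take k w"
      using y by (simp add: sorted_list_of_set.idem_if_sorted_distinct)
    then show "(case case y of (w, k) \<Rightarrow> (set (take k w), drop k w) of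
        (K, v) \<Rightarrow> (sorted_list_of_set K @ v, card K)) = y"
      using y by (simp add: distinct_card)
    have "set (drop k w) = A - set (take k w)"
      using y(2,3) by (metis append_take_drop_id distinct_append set_append Diff_cancel Un_Diff
          Diff_triv Int_commute sup_bot_left)
    then show "(case y of (w, k) \<Rightarrow> (set (take k w), drop k w)) \<in> (SIGMA K:Pow A. G (A - K))"
      using y by (auto simp: G_def dest: in_set_takeD)
  qed
  also have "\<dots> = (\<Sum>w\<in>P A. \<Sum>k\<in>{k. k \<le> length w \<and> sorted (take k w) \<and>
      set (run_lengths (drop k w)) \<subseteq> S}. a k)"
    using fP[OF assms(4)] by (intro sum.Sigma[symmetric]) auto
  also have "\<dots> = (\<Sum>w\<in>P A. \<Sum>k\<le>length w. (if sorted (take k w) then a k else 0) *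
      (if set (run_lengths (drop k w)) \<subseteq> S then 1 else 0))"
    by (intro sum.cong refl sum.mono_neutral_cong_left) auto
  also have "\<dots> = (\<Sum>w\<in>P A. if w = [] then 1 else 0)"
    using assms(1-3) by (simp add: convolution_run_lengths)
  also have "\<dots> = (if A = {} then 1 else 0)"
    using fP[OF assms(4)] by (auto simp: P_def intro!: sum.neutral)
  finally show ?thesis unfolding G_def .
qed

lemma sum_Pow_card:
  fixes f :: "nat \<Rightarrow> 'a::comm_semiring_1"
  assumes "finite A"
  shows "(\<Sum>K\<in>Pow A. f (card K)) = (\<Sum>k\<le>card A. of_nat (card A choose k) * f k)"
proof -
  have "(\<Sum>K\<in>Pow A. f (card K)) = (\<Sum>k\<le>card A. \<Sum>K\<in>{K \<in> Pow A. card K = k}. f (card K))"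
    using assms by (intro sum.group[symmetric]) (auto intro: card_mono)
  also have "\<dots> = (\<Sum>k\<le>card A. of_nat (card A choose k) * f k)"
  proof (rule sum.cong[OF refl])
    fix k
    have "(\<Sum>K\<in>{K \<in> Pow A. card K = k}. f (card K)) = (\<Sum>K\<in>{K. K \<subseteq> A \<and> card K = k}. f k)"
      by (rule sum.cong) auto
    then show "(\<Sum>K\<in>{K \<in> Pow A. card K = k}. f (card K)) = of_nat (card A choose k) * f k"
      using n_subsets[OF assms, of k] by simp
  qed
  finally show ?thesis .
qed

text \<open>The counts satisfy the subset recurrence of \<open>sum_card_arrangements\<close>.
  Grouping subsets by size shows that the scaled coefficients of the inverse satisfy it too, so the
  two agree by induction.\<close>

lemma card_arrangements_eq_inverse_coeff:
  fixes a :: "nat \<Rightarrow> 'a::field_char_0" and A :: "'b::linorder set"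
  assumes S: "0 \<in> S" and a0: "a 0 = 1"
    and conv: "\<And>l. 0 < l \<Longrightarrow> (\<Sum>k\<le>l. a k * (if l - k \<in> S then 1 else 0)) = 0"
    and "finite A"
  shows "of_nat (card {w. distinct w \<and> set w = A \<and> set (run_lengths w) \<subseteq> S}) =
    fact (card A) * fps_nth (inverse (Abs_fps (\<lambda>k. a k / fact k))) (card A)"
  using \<open>finite A\<close>
proof (induction A rule: finite_psubset_induct)
  case (psubset A)
  \<comment> \<open>The term \<open>K = {}\<close> of \<open>sum_card_arrangements\<close> expresses the count for \<open>A\<close> through counts
    for proper subsets.\<close>
  define N where "N B = card {w. distinct w \<and> set w = B \<and> set (run_lengths w) \<subseteq> S}"
    for B :: "'b set"
  define g where "g = inverse (Abs_fps (\<lambda>k. a k / fact k))"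
  define n where "n = card A"
  have fg: "Abs_fps (\<lambda>k. a k / fact k) * g = 1"
    unfolding g_def by (rule inverse_mult_eq_1') (simp add: a0)
  \<comment> \<open>Since \<open>(n choose k) * fact (n - k)\<close> is
    \<open>fact n / fact k\<close>, the binomial sum is a scaled coefficient of an ordinary
    product.\<close>
  have "(\<Sum>k\<le>n. of_nat (n choose k) * (a k * (fact (n - k) * fps_nth g (n - k)))) =
    (\<Sum>k\<le>n. fact n * (a k / fact k * fps_nth g (n - k)))"
    by (intro sum.cong refl) (auto simp: binomial_fact field_simps)
  also have "\<dots> = fact n * fps_nth (Abs_fps (\<lambda>k. a k / fact k) * g) n"
    by (simp add: fps_mult_nth sum_distrib_left atLeast0AtMost)
  also have "\<dots> = (if A = {} then 1 else 0)"
    using psubset(1) by (simp add: fg n_def)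
  finally have "(\<Sum>K\<in>Pow A. a (card K) * (fact (n - card K) * fps_nth g (n - card K))) =
      (if A = {} then 1 else 0)"
    using sum_Pow_card[OF psubset(1), of "\<lambda>k. a k * (fact (n - k) * fps_nth g (n - k))"]
    by (simp add: n_def)
  also have "\<dots> = (\<Sum>K\<in>Pow A. a (card K) * of_nat (N (A - K)))"
    unfolding N_def by (rule sum_card_arrangements[symmetric]) (use assms psubset in auto)
  finally have eq: "(\<Sum>K\<in>Pow A. a (card K) * (fact (n - card K) * fps_nth g (n - card K))) =
    (\<Sum>K\<in>Pow A. a (card K) * of_nat (N (A - K)))" .
  have rest: "(\<Sum>K\<in>Pow A - {{}}. a (card K) * (fact (n - card K) * fps_nth g (n - card K))) =
    (\<Sum>K\<in>Pow A - {{}}. a (card K) * of_nat (N (A - K)))"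
  proof (rule sum.cong[OF refl])
    fix K assume K: "K \<in> Pow A - {{}}"
    then have "A - K \<subset> A" by blast
    moreover have "card (A - K) = n - card K"
      using K psubset(1) finite_subset[of K A] by (simp add: n_def card_Diff_subset)
    ultimately show "a (card K) * (fact (n - card K) * fps_nth g (n - card K)) =
        a (card K) * of_nat (N (A - K))"
      using psubset(2)[of "A - K"] by (simp add: N_def g_def)
  qed
  have "finite (Pow A)" "{} \<in> Pow A" using psubset(1) by auto
  from eq[unfolded sum.remove[OF this] rest] show ?case
    by (simp add: a0 N_def n_def g_def)
qed

section \<open>Permutations in one-line notation\<close>

lemma bij_betw_one_line:
  "bij_betw (one_line n) {p. p permutes {1..n}} {w. distinct w \<and> set w = {1..n}}"
\<comment> \<open>The inverse reads \<open>w\<close> with 1-based positions and fixes everything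
  outside \<open>{1..n}\<close>, as \<open>permutes\<close> demands.\<close>
proof (rule bij_betwI[where g = "\<lambda>w i. if i \<in> {1..n} then w ! (i - 1) else i"])
  show "one_line n \<in> {p. p permutes {1..n}} \<rightarrow> {w. distinct w \<and> set w = {1..n}}"
  proof safe
    fix p assume p: "p permutes {1..n}"
    have set: "set [1..<Suc n] = {1..n}" by auto
    show "distinct (one_line n p)"
      using p unfolding one_line_def distinct_map by (simp add: permutes_inj_on)
    have "set (one_line n p) = p ` {1..n}" unfolding one_line_def set_map set ..
    then have eq: "set (one_line n p) = {1..n}" using permutes_image[OF p] by simp
    show "x \<in> {1..n}" if "x \<in> set (one_line n p)" for x using that eq by simp
    show "x \<in> set (one_line n p)" if "x \<in> {1..n}" for x using that eq by simp
  qed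
  show "(\<lambda>w i. if i \<in> {1..n} then w ! (i - 1) else i) \<in>
    {w. distinct w \<and> set w = {1..n}} \<rightarrow> {p. p permutes {1..n}}"
  proof safe
    fix w :: "nat list" assume w: "distinct w" "set w = {1..n}"
    then have len: "length w = n" using distinct_card[of w] by simp
    show "(\<lambda>i. if i \<in> {1..n} then w ! (i - 1) else i) permutes {1..n}"
    proof (rule bij_imp_permutes)
      have "inj_on (\<lambda>i. if i \<in> {1..n} then w ! (i - 1) else i) {1..n}"
        using w len by (auto simp: inj_on_def nth_eq_iff_index_eq)
      moreover have "(\<lambda>i. if i \<in> {1..n} then w ! (i - 1) else i) ` {1..n} \<subseteq> {1..n}"
      proof safe
        fix i assume i: "i \<in> {1..n}"
        then have "w ! (i - 1) \<in> set w" using len by (intro nth_mem) auto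
        then show "(if i \<in> {1..n} then w ! (i - 1) else i) \<in> {1..n}" using w i by simp
      qed
      ultimately show "bij_betw (\<lambda>i. if i \<in> {1..n} then w ! (i - 1) else i) {1..n} {1..n}"
        unfolding bij_betw_def by (meson endo_inj_surj finite_atLeastAtMost)
    qed auto
  qed
next
  fix p assume "p \<in> {p. p permutes {1..n}}"
  then have p: "p permutes {1..n}" by simp
  show "(\<lambda>i. if i \<in> {1..n} then one_line n p ! (i - 1) else i) = p"
  proof
    fix i
    show "(if i \<in> {1..n} then one_line n p ! (i - 1) else i) = p i"
      using permutes_not_in[OF p] by (auto simp: one_line_def simp del: upt_Suc)
  qed
next
  fix w :: "nat list" assume "w \<in> {w. distinct w \<and> set w = {1..n}}"
  then have len: "length w = n" using distinct_card[of w] by simp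
  then show "one_line n (\<lambda>i. if i \<in> {1..n} then w ! (i - 1) else i) = w"
    by (intro nth_equalityI) (auto simp: one_line_def simp del: upt_Suc)
qed

text \<open>One-line words have distinct letters, so \<open>increasing_run_lengths_eq\<close>
  applies to them.\<close>

lemma card_permutations_run_lengths:
  "card {p. p permutes {1..n} \<and> increasing_run_lengths (one_line n p) \<subseteq> S} =
    card {w. distinct w \<and> set w = {1..n} \<and> set (run_lengths w) \<subseteq> S}"
proof -
  have "bij_betw (one_line n)
    {p \<in> {p. p permutes {1..n}}. increasing_run_lengths (one_line n p) \<subseteq> S}
    {w \<in> {w. distinct w \<and> set w = {1..n}}. set (run_lengths w) \<subseteq> S}"
    using bij_betw_one_line
  proof (rule bij_betw_Collect)
    fix p assume "p \<in> {p. p permutes {1..n}}"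
    then have "distinct (one_line n p)"
      using bij_betwE[OF bij_betw_one_line, of n] by blast
    then show "set (run_lengths (one_line n p)) \<subseteq> S \<longleftrightarrow>
        increasing_run_lengths (one_line n p) \<subseteq> S"
      by (simp add: increasing_run_lengths_eq)
  qed
  then have "card {p \<in> {p. p permutes {1..n}}. increasing_run_lengths (one_line n p) \<subseteq> S} =
    card {w \<in> {w. distinct w \<and> set w = {1..n}}. set (run_lengths w) \<subseteq> S}"
    by (rule bij_betw_same_card)
  then show ?thesis by (simp add: conj_assoc)
qed

section \<open>Periodicity\<close>

text \<open>A window of \<open>D\<close> consecutive values determines the next value since
  \<open>c D \<noteq> 0\<close> and the previous one since \<open>c 0 \<noteq> 0\<close>. There are
  only finitely many windows, so two coincide, and the resulting period reaches back to index
  0.\<close>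

lemma linear_recurrence_periodic:
  fixes c :: "nat \<Rightarrow> 'a::field" and b :: "nat \<Rightarrow> 'a"
  assumes c0: "c 0 \<noteq> 0" and cD: "c D \<noteq> 0"
    and rec: "\<And>i. (\<Sum>k\<le>D. c k * b (i + k)) = 0"
    and fin: "finite (range b)"
  obtains m where "0 < m" "\<And>i. b (i + m) = b i"
proof -
  define win where "win i = map (\<lambda>j. b (i + j)) [0..<D]" for i
  have "range win \<subseteq> {xs. set xs \<subseteq> range b \<and> length xs = D}" by (auto simp: win_def)
  then have "finite (range win)"
    using finite_lists_length_eq[OF fin] finite_subset by blast
  then have "\<not> inj win" using finite_imageD infinite_UNIV_nat by blast
  then obtain i i' where ii: "i < i'" "win i = win i'"
    unfolding inj_def by (metis linorder_neqE_nat)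
  define m where "m = i' - i"
  \<comment> \<open>The difference from the shifted sequence obeys the same recurrence, so it
    suffices to propagate its zeros in both directions.\<close>
  define e where "e j = b (j + m) - b j" for j
  have e_rec: "(\<Sum>k\<le>D. c k * e (j + k)) = 0" for j
  proof -
    have "(\<Sum>k\<le>D. c k * e (j + k)) = (\<Sum>k\<le>D. c k * b ((j + m) + k)) - (\<Sum>k\<le>D. c k * b (j + k))"
      by (simp add: e_def sum_subtractf[symmetric] algebra_simps)
    then show ?thesis by (simp only: rec) simp
  qed
  have start: "e (i + j) = 0" if "j < D" for j
  proof -
    have "win i ! j = win i' ! j" using ii by simp
    then show ?thesis using that ii by (simp add: win_def e_def m_def add.commute add.left_commute)
  qed
  have window_eq_0: "\<forall>j<D. e (t + j) = 0" if "t \<le> i" for t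
    using that
  proof (induction t rule: inc_induct)
    case base
    then show ?case using start by blast
  next
    case (step t)
    \<comment> \<open>The window at \<open>Suc t\<close> vanishes, so the recurrence at
      \<open>t\<close> reduces to its term with \<open>c 0\<close>.\<close>
    have "e (t + k) = 0" if "0 < k" "k \<le> D" for k
      using step.IH[rule_format, of "k - 1"] that by simp
    then have "(\<Sum>k\<le>D. c k * e (t + k)) = (\<Sum>k\<in>{0}. c k * e (t + k))"
      by (intro sum.mono_neutral_right) auto
    then have "e t = 0" using e_rec[of t] c0 by simp
    then show ?case using \<open>\<And>k. 0 < k \<Longrightarrow> k \<le> D \<Longrightarrow> e (t + k) = 0\<close>
      by (metis add_0_right less_imp_le neq0_conv)
  qed
  have "e j = 0" for j
  proof (induction j rule: less_induct)
    case (less j)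
    show ?case
    proof (cases "j < D")
      case True
      then show ?thesis using window_eq_0[of 0] by simp
    next
      case False
      have "(\<Sum>k\<le>D. c k * e ((j - D) + k)) = (\<Sum>k\<in>{D}. c k * e ((j - D) + k))"
        using False by (intro sum.mono_neutral_right) (auto intro!: less)
      then show ?thesis using e_rec[of "j - D"] cD False by simp
    qed
  qed
  then show thesis using that[of m] ii by (simp add: e_def m_def)
qed

text \<open>The product of \<open>a\<close> and its inverse yields a recurrence with reversed
  coefficients: its first is the leading and its last the constant coefficient of \<open>a\<close>,
  both nonzero. Positive degree excludes nonzero constants, whose inverses are not periodic from
  index 0.\<close>

lemma inverse_fps_of_poly_periodic:
  fixes a :: "'a::field poly"
  assumes a0: "coeff a 0 \<noteq> 0" and deg: "0 < degree a"
    and fin: "finite (range (fps_nth (inverse (fps_of_poly a))))"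
  obtains m where "0 < m"
    "\<And>i. fps_nth (inverse (fps_of_poly a)) (i + m) = fps_nth (inverse (fps_of_poly a)) i"
proof -
  define D where "D = degree a"
  define b where "b = fps_nth (inverse (fps_of_poly a))"
  \<comment> \<open>Shifting by \<open>D - 1\<close> zeros makes the recurrence hold from the very first index,
    so that the period starts at once.\<close>
  define b' where "b' i = (if i < D - 1 then 0 else b (i - (D - 1)))" for i
  have "fps_of_poly a * inverse (fps_of_poly a) = 1"
    by (rule inverse_mult_eq_1') (simp add: a0)
  then have conv: "(\<Sum>k\<le>n. coeff a k * b (n - k)) = (if n = 0 then 1 else 0)" for n
    by (metis (no_types, lifting) atLeast0AtMost b_def fps_mult_nth fps_of_poly_nth fps_one_nth sum.cong)
  have rec: "(\<Sum>k\<le>D. coeff a (D - k) * b' (i + k)) = 0" for i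
  proof -
    have "(\<Sum>k\<le>D. coeff a (D - k) * b' (i + k)) = (\<Sum>k\<le>D. coeff a k * b' (i + (D - k)))"
      by (rule sum.reindex_bij_witness[where i = "\<lambda>k. D - k" and j = "\<lambda>k. D - k"]) auto
    \<comment> \<open>This is the coefficient of x^(i+1) in the product, never the constant one, so
      it is 0 for every \<open>i\<close>.\<close>
    also have "\<dots> = (\<Sum>k\<le>Suc i. coeff a k * b (Suc i - k))"
    proof -
      \<comment> \<open>Terms with \<open>k > Suc i\<close> fall on the zeros padded in front of
        \<open>b\<close>.\<close>
      have "(\<Sum>k\<le>D. coeff a k * b' (i + (D - k))) =
        (\<Sum>k\<in>{..D} \<inter> {..Suc i}. coeff a k * b' (i + (D - k)))"
        by (intro sum.mono_neutral_right) (auto simp: b'_def)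
      also have "\<dots> = (\<Sum>k\<in>{..D} \<inter> {..Suc i}. coeff a k * b (Suc i - k))"
      proof (rule sum.cong[OF refl])
        fix k assume "k \<in> {..D} \<inter> {..Suc i}"
        then have "\<not> i + (D - k) < D - 1" "i + (D - k) - (D - 1) = Suc i - k"
          using deg by (auto simp: D_def)
        then show "coeff a k * b' (i + (D - k)) = coeff a k * b (Suc i - k)"
          by (simp add: b'_def)
      qed
      also have "\<dots> = (\<Sum>k\<le>Suc i. coeff a k * b (Suc i - k))"
        by (intro sum.mono_neutral_left) (auto simp: D_def coeff_eq_0)
      finally show ?thesis .
    qed
    finally show ?thesis using conv[of "Suc i"] by simp
  qed
  have "range b' \<subseteq> insert 0 (range b)" by (auto simp: b'_def)
  then have "finite (range b')" using fin finite_subset unfolding b_def by blast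
  moreover have "coeff a D \<noteq> 0" using deg by (auto simp: D_def)
  ultimately obtain m where m: "0 < m" "\<And>i. b' (i + m) = b' i"
    using linear_recurrence_periodic[of "\<lambda>k. coeff a (D - k)" D b'] rec a0 by auto
  have "b (i + m) = b i" for i
    using m(2)[of "i + (D - 1)"] by (simp add: b'_def add.commute add.left_commute)
  then show thesis using that m(1) unfolding b_def by blast
qed

text \<open>One set of residue classes has to serve all three formulas. Positive degree excludes the
  polynomial 1, whose inverse is not the indicator of a union of residue classes.\<close>

theorem theorem1:
  fixes a :: "complex poly" and d :: nat
  assumes "degree a \<le> d"
    and "coeff a 0 = 1"
    and "0 < degree a"
    and "\<And>n. fps_nth (inverse (fps_of_poly a)) n \<in> {0, 1}"
  shows "\<exists>(m::nat) T. 0 < m \<and> T \<subseteq> {0..m - 1} \<and> 0 \<in> T \<and>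
    inverse (fps_of_poly a) = Abs_fps (\<lambda>n. if n \<in> residue_closure m T then 1 else 0) \<and>
    (\<exists>R. ncps_has_sum nc_ribbon {L. is_composition L \<and> set L \<subseteq> residue_closure m T} R \<and>
       ncps_is_inverse (\<Sum>n\<le>d. ncps_smult (coeff a n) (nc_complete n)) R) \<and>
    (\<forall>n. fact n *
        fps_nth (inverse (\<Sum>k\<le>d. fps_const (coeff a k / fact k) * fps_X ^ k)) n =
      of_nat (card {p. p permutes {1..n} \<and>
        increasing_run_lengths (one_line n p) \<subseteq> residue_closure m T}))"
proof -
  define b where "b = fps_nth (inverse (fps_of_poly a))"
  have b01: "b n = 0 \<or> b n = 1" for n using assms(4)[of n] by (simp add: b_def)
  have "range b \<subseteq> {0, 1}" using assms(4) by (auto simp: b_def)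
  then have "finite (range b)" by (rule finite_subset) simp
  then obtain m where m: "0 < m" "\<And>i. b (i + m) = b i"
    using inverse_fps_of_poly_periodic[of a] assms(2,3) unfolding b_def by auto
  define T where "T = {t. t < m \<and> b t = 1}"
  define S where "S = residue_closure m T"
  have b_mult: "b (i + q * m) = b i" for i q
  proof (induction q)
    case (Suc q)
    then show ?case using m(2)[of "i + q * m"] by (simp add: algebra_simps)
  qed simp
  have b_mod: "b (n mod m) = b n" for n
    using b_mult[of "n mod m" "n div m"] by simp
  have S_iff: "n \<in> S \<longleftrightarrow> b n = 1" for n
  proof
    assume "n \<in> S"
    then obtain t where "t < m" "b t = 1" "[n = t] (mod m)"
      by (auto simp: S_def residue_closure_def T_def)
    then show "b n = 1" using b_mod[of n] by (simp add: cong_def)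
  next
    assume "b n = 1"
    then have "n mod m \<in> T" using m(1) b_mod[of n] by (simp add: T_def)
    then show "n \<in> S" unfolding S_def residue_closure_def
      by (auto simp: cong_def intro!: bexI[of _ "n mod m"])
  qed
  \<comment> \<open>The restriction to values 0 and 1 makes \<open>b\<close> the indicator function
    of \<open>S\<close>.\<close>
  have b_eq: "b n = (if n \<in> S then 1 else 0)" for n using S_iff b01 by auto
  have b0: "b 0 = 1" by (simp add: b_def assms(2))
  have "fps_of_poly a * inverse (fps_of_poly a) = 1"
    by (rule inverse_mult_eq_1') (simp add: assms(2))
  then have "(\<Sum>k\<le>l. coeff a k * b (l - k)) = (if l = 0 then 1 else 0)" for l
    by (metis (no_types, lifting) atLeast0AtMost b_def fps_mult_nth fps_of_poly_nth fps_one_nth sum.cong)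
  then have conv: "(\<Sum>k\<le>l. coeff a k * (if l - k \<in> S then 1 else 0)) = 0" if "0 < l" for l
    using that unfolding b_eq by simp
  have S0: "0 \<in> S" using b0 S_iff by simp
  have high: "coeff a k = 0" if "d < k" for k using that assms(1) by (simp add: coeff_eq_0)
  \<comment> \<open>Truncation at \<open>d\<close> loses no coefficient, so this is the full series
    that \<open>card_arrangements_eq_inverse_coeff\<close> inverts.\<close>
  have exp_series: "(\<Sum>k\<le>d. fps_const (coeff a k / fact k) * fps_X ^ k) =
    Abs_fps (\<lambda>k. coeff a k / fact k)"
  proof (rule fps_ext)
    fix n
    have "fps_nth (\<Sum>k\<le>d. fps_const (coeff a k / fact k) * fps_X ^ k) n =
      (\<Sum>k\<le>d. if k = n then coeff a k / fact k else 0)"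
      unfolding fps_sum_nth by (intro sum.cong) (auto simp: fps_X_power_nth)
    then show "fps_nth (\<Sum>k\<le>d. fps_const (coeff a k / fact k) * fps_X ^ k) n =
      fps_nth (Abs_fps (\<lambda>k. coeff a k / fact k)) n"
      using high[of n] by (simp add: not_le)
  qed
  show ?thesis
  proof (intro exI[of _ m] exI[of _ T] conjI allI)
    show "0 < m" by (rule m)
    show "T \<subseteq> {0..m - 1}" by (auto simp: T_def)
    show "0 \<in> T" using m(1) b0 by (simp add: T_def)
    show "inverse (fps_of_poly a) = Abs_fps (\<lambda>n. if n \<in> residue_closure m T then 1 else 0)"
      by (rule fps_ext) (simp add: b_eq[unfolded b_def] S_def)
    show "\<exists>R. ncps_has_sum nc_ribbon {L. is_composition L \<and> set L \<subseteq> residue_closure m T} R \<and>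
       ncps_is_inverse (\<Sum>n\<le>d. ncps_smult (coeff a n) (nc_complete n)) R"
      unfolding S_def[symmetric]
      using ncps_has_sum_nc_ribbon ncps_is_inverse_run_lengths[of S "coeff a" d, OF S0 assms(2) high conv]
      by blast
    show "fact n * fps_nth (inverse (\<Sum>k\<le>d. fps_const (coeff a k / fact k) * fps_X ^ k)) n =
      of_nat (card {p. p permutes {1..n} \<and>
        increasing_run_lengths (one_line n p) \<subseteq> residue_closure m T})" for n
      unfolding S_def[symmetric] card_permutations_run_lengths exp_series
      using card_arrangements_eq_inverse_coeff[of S "coeff a" "{1..n}", OF S0 assms(2) conv] by simp
  qed
qed

end
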